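(* Let $X$ be a geodesic metric space whose completion $\overline{X}$ is also geodesic (so that the near-geodesic definition of geodesic complexity applies to $X$). Then $\mathrm{GC}(X)$ as defined by near-geodesic motion planning rules equals $\mathrm{GC}_{\mathrm{RM}}(X)$, the geodesic complexity of $X$ in the sense of Recio-Mitter.
   Context: Let $I=[0,1]$. For a topological space $Z$, $P(Z)=Z^I$ is the space of continuous maps $I\to Z$ with the compact-open topology, and $P(Z;z_0,z_1)$ is the subspace of paths from $z_0$ to $z_1$. The length of a path in a metric space is the supremum of the sums of distances between successive points on the path. A (minimal) geodesic from $x_0$ to $x_1$ in a metric space $(Z,d)$ is a path $\gamma$ from $x_0$ to $x_1$ with $d(\gamma(t),\gamma(t'))=|t-t'|\,d(x_0,x_1)$ for all $t,t'\in I$. A metric space is geodesic if every pair of its points is joined by a geodesic. Recio-Mitter's definition: $\mathrm{GC}_{\mathrm{RM}}(X)$ is the smallest $k$ such that $X\times X$ can be partitioned into $k+1$ locally compact sets $E_0,\ldots,E_k$ such that on each $E_i$ there is a continuous map $s_i:E_i\to P(X)$ such that, for all $(x_0,x_1)\in E_i$, $s_i(x_0,x_1)$ is a geodesic in $X$ from $x_0$ to $x_1$. Near-geodesic definition: let $X$ be a metric space whose completion $\overline{X}$ is geodesic. For $x_0,x_1\in X$, a near-geodesic from $x_0$ to $x_1$ is a continuous map $\phi:I\to P(\overline{X};x_0,x_1)$ such that (i) $\phi(0)$ is a geodesic in $\overline{X}$ from $x_0$ to $x_1$; (ii) $\phi((0,1])\subset P(X;x_0,x_1)$; (iii) if $s_n\to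 0$, then $\operatorname{length}(\phi(s_n))\to\operatorname{length}(\phi(0))$. For $E\subset X\times X$, a near-geodesic motion planning rule (NGMPR) on $E$ is a continuous map $\Phi:E\to P(\overline{X})^I$ such that, for all $(x_0,x_1)\in E$, $\Phi(x_0,x_1)$ is a near-geodesic from $x_0$ to $x_1$, with the additional proviso that $\Phi(x_0,x_1)(0)$ is a geodesic in $X$ if a geodesic in $X$ from $x_0$ to $x_1$ exists. The geodesic complexity $\mathrm{GC}(X)$ is the smallest $k$ such that $X\times X$ can be partitioned into locally compact sets $E_0,\ldots,E_k$ such that each $E_i$ has an NGMPR. In both definitions the value is $\infty$ if no such $k$ exists. *)

theory Defs
  imports "HOL-Analysis.Analysis" "HOL-Library.Extended_Nat"
begin

text \<open>
  The space \<open>Y\<^sup>X\<close> of continuous maps with the compact-open topology. Its points are extensional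
  functions, so that a point is determined by its values on \<^term>\<open>topspace X\<close>.
\<close>

definition compact_open :: "'a topology \<Rightarrow> 'b topology \<Rightarrow> ('a \<Rightarrow> 'b) topology" where
  "compact_open X Y =
     subtopology
       (topology_generated_by {{f. f ` K \<subseteq> U} | K U. compactin X K \<and> openin Y U})
       {f \<in> extensional (topspace X). continuous_map X Y f}"

abbreviation unit_interval :: "real topology" where
  "unit_interval \<equiv> top_of_set {0..1}"

abbreviation path_space :: "'a topology \<Rightarrow> (real \<Rightarrow> 'a) topology" where
  "path_space Z \<equiv> compact_open unit_interval Z"

definition path_space_between :: "'a topology \<Rightarrow> 'a \<Rightarrow> 'a \<Rightarrow> (real \<Rightarrow> 'a) topology" where
  "path_space_between Z z0 z1 = subtopology (path_space Z) {\<gamma>. \<gamma> 0 = z0 \<and> \<gamma> 1 = z1}"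

definition path_length :: "'a metric \<Rightarrow> (real \<Rightarrow> 'a) \<Rightarrow> ennreal" where
  "path_length Z \<gamma> =
     (SUP ts \<in> {ts. sorted ts \<and> set ts \<subseteq> {0..1}}.
        \<Sum>k<length ts - 1. ennreal (mdist Z (\<gamma> (ts ! k)) (\<gamma> (ts ! Suc k))))"

definition geodesic :: "'a metric \<Rightarrow> 'a \<Rightarrow> 'a \<Rightarrow> (real \<Rightarrow> 'a) \<Rightarrow> bool" where
  "geodesic Z x0 x1 \<gamma> \<longleftrightarrow>
     \<gamma> \<in> topspace (path_space_between (mtopology_of Z) x0 x1) \<and>
     (\<forall>t\<in>{0..1}. \<forall>t'\<in>{0..1}. mdist Z (\<gamma> t) (\<gamma> t') = \<bar>t - t'\<bar> * mdist Z x0 x1)"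

definition geodesic_space :: "'a metric \<Rightarrow> bool" where
  "geodesic_space Z \<longleftrightarrow> (\<forall>x0\<in>mspace Z. \<forall>x1\<in>mspace Z. \<exists>\<gamma>. geodesic Z x0 x1 \<gamma>)"

text \<open>
  A completion of \<open>X\<close> is a complete metric space \<open>Y\<close> together with an isometric embedding
  \<open>\<iota>\<close> of \<open>X\<close> onto a dense subset of \<open>Y\<close>. Where one usually regards \<open>X\<close> as a subset of its
  completion, we write the embedding explicitly; a path \<open>\<gamma>\<close> in \<open>X\<close> becomes the path
  \<^term>\<open>compose {0..1} \<iota> \<gamma>\<close> in \<open>Y\<close>.
\<close>

definition is_completion :: "'a metric \<Rightarrow> 'b metric \<Rightarrow> ('a \<Rightarrow> 'b) \<Rightarrow> bool" where
  "is_completion X Y \<iota> \<longleftrightarrow>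
     mcomplete_of Y \<and>
     \<iota> \<in> mspace X \<rightarrow> mspace Y \<and>
     (\<forall>x\<in>mspace X. \<forall>x'\<in>mspace X. mdist Y (\<iota> x) (\<iota> x') = mdist X x x') \<and>
     mtopology_of Y closure_of (\<iota> ` mspace X) = mspace Y"

definition near_geodesic ::
  "'a metric \<Rightarrow> 'b metric \<Rightarrow> ('a \<Rightarrow> 'b) \<Rightarrow> 'a \<Rightarrow> 'a \<Rightarrow> (real \<Rightarrow> real \<Rightarrow> 'b) \<Rightarrow> bool" where
  "near_geodesic X Y \<iota> x0 x1 \<phi> \<longleftrightarrow>
     \<phi> \<in> topspace (path_space (path_space_between (mtopology_of Y) (\<iota> x0) (\<iota> x1))) \<and>
     geodesic Y (\<iota> x0) (\<iota> x1) (\<phi> 0) \<and>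
     \<phi> ` {0<..1} \<subseteq>
       compose {0..1} \<iota> ` topspace (path_space_between (mtopology_of X) x0 x1) \<and>
     (\<forall>s::nat \<Rightarrow> real. range s \<subseteq> {0..1} \<and> s \<longlonglongrightarrow> 0 \<longrightarrow>
        (\<lambda>n. path_length Y (\<phi> (s n))) \<longlonglongrightarrow> path_length Y (\<phi> 0))"

definition square :: "'a metric \<Rightarrow> ('a \<times> 'a) topology" where
  "square X = prod_topology (mtopology_of X) (mtopology_of X)"

definition NGMPR ::
  "'a metric \<Rightarrow> 'b metric \<Rightarrow> ('a \<Rightarrow> 'b) \<Rightarrow> ('a \<times> 'a) set
     \<Rightarrow> ('a \<times> 'a \<Rightarrow> real \<Rightarrow> real \<Rightarrow> 'b) \<Rightarrow> bool" where
  "NGMPR X Y \<iota> E \<Phi> \<longleftrightarrow>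
     continuous_map (subtopology (square X) E) (path_space (path_space (mtopology_of Y))) \<Phi> \<and>
     (\<forall>(x0, x1)\<in>E.
        near_geodesic X Y \<iota> x0 x1 (\<Phi> (x0, x1)) \<and>
        ((\<exists>\<gamma>. geodesic X x0 x1 \<gamma>) \<longrightarrow>
           \<Phi> (x0, x1) 0 \<in> compose {0..1} \<iota> ` {\<gamma>. geodesic X x0 x1 \<gamma>}))"

definition RM_rule ::
  "'a metric \<Rightarrow> ('a \<times> 'a) set \<Rightarrow> ('a \<times> 'a \<Rightarrow> real \<Rightarrow> 'a) \<Rightarrow> bool" where
  "RM_rule X E s \<longleftrightarrow>
     continuous_map (subtopology (square X) E) (path_space (mtopology_of X)) s \<and>
     (\<forall>(x0, x1)\<in>E. geodesic X x0 x1 (s (x0, x1)))"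

text \<open>
  Partitions into \<open>k + 1\<close> sets may have empty members; allowing them does not change the smallest
  \<open>k\<close> unless \<open>X\<close> is empty.
\<close>

definition lc_partition :: "'a metric \<Rightarrow> nat \<Rightarrow> (nat \<Rightarrow> ('a \<times> 'a) set) \<Rightarrow> bool" where
  "lc_partition X k E \<longleftrightarrow>
     (\<Union>i\<le>k. E i) = mspace X \<times> mspace X \<and> disjoint_family_on E {..k} \<and>
     (\<forall>i\<le>k. locally_compact_space (subtopology (square X) (E i)))"

text \<open>In both definitions the infimum of the empty set is \<open>\<infinity>\<close>.\<close>

definition GC_RM :: "'a metric \<Rightarrow> enat" where
  "GC_RM X = Inf {enat k | k. \<exists>E. lc_partition X k E \<and> (\<forall>i\<le>k. \<exists>s. RM_rule X (E i) s)}"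

definition GC :: "'a metric \<Rightarrow> 'b metric \<Rightarrow> ('a \<Rightarrow> 'b) \<Rightarrow> enat" where
  "GC X Y \<iota> = Inf {enat k | k. \<exists>E. lc_partition X k E \<and> (\<forall>i\<le>k. \<exists>\<Phi>. NGMPR X Y \<iota> (E i) \<Phi>)}"

end

theory Submission
  imports Defs
begin

text \<open>
  Both invariants are infima over the same partitions of \<open>X \<times> X\<close>, so it suffices to show that a set
  \<open>E\<close> of pairs of points of \<open>X\<close> carries a near-geodesic motion planning rule exactly if it carries a
  continuous choice of geodesics in \<open>X\<close>.

  A choice \<open>s\<close> of geodesics in \<open>X\<close> is turned into near-geodesics that do not move:
  \<open>\<Phi> x r = \<iota> \<circ> s x\<close> for every \<open>r\<close>. The convergence of lengths is then trivial, and \<open>\<Phi>\<close> is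
  continuous because postcomposition with \<open>\<iota>\<close> and \<open>z \<mapsto> const z\<close> are continuous for the
  compact-open topologies.

  Conversely, since \<open>X\<close> is geodesic, the proviso in the definition of a near-geodesic motion planning
  rule applies to every pair, so \<open>\<Phi> x 0\<close> is always \<open>\<iota> \<circ> \<gamma>\<close> for a geodesic \<open>\<gamma>\<close> of \<open>X\<close>. Its
  continuity in \<open>x\<close>, as a path of the completion, is that of evaluation at \<open>0\<close>; the point is that
  \<open>\<gamma>\<close> depends continuously on \<open>x\<close> as a path of \<open>X\<close>. This holds because \<open>\<iota>\<close> is a topological
  embedding, and postcomposition with an embedding reflects continuity into the compact-open
  topology (\<open>continuous_map_compact_open_embedding_iff\<close>).
\<close>

section \<open>The compact-open topology\<close>

lemma topspace_compact_open:
  "topspace (compact_open X Y) = {f \<in> extensional (topspace X). continuous_map X Y f}"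
proof -
  \<comment> \<open>The empty compact set contributes the whole type to the subbasis.\<close>
  have "UNIV \<in> {{f. f ` K \<subseteq> U} | K U. compactin X K \<and> openin Y U}"
    by (intro CollectI exI[of _ "{}"]) auto
  then have "\<Union> {{f. f ` K \<subseteq> U} | K U. compactin X K \<and> openin Y U} = UNIV"
    by blast
  then show ?thesis
    by (simp add: compact_open_def topology_generated_by_topspace)
qed

lemma continuous_map_into_compact_open_iff:
  "continuous_map T (compact_open X Y) F \<longleftrightarrow>
     F \<in> topspace T \<rightarrow> topspace (compact_open X Y) \<and>
     (\<forall>K U. compactin X K \<and> openin Y U \<longrightarrow> openin T {x \<in> topspace T. F x ` K \<subseteq> U})"
proof -
  let ?S = "{{f. f ` K \<subseteq> U} | K U. compactin X K \<and> openin Y U}"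
  have "UNIV \<in> ?S"
    by (intro CollectI exI[of _ "{}"]) auto
  then have U: "\<Union> ?S = UNIV"
    by blast
  have pre: "F -` {f. f ` K \<subseteq> U} \<inter> topspace T = {x \<in> topspace T. F x ` K \<subseteq> U}" for K U
    by auto
  have "continuous_map T (topology_generated_by ?S) F \<longleftrightarrow>
      (\<forall>K U. compactin X K \<and> openin Y U \<longrightarrow> openin T {x \<in> topspace T. F x ` K \<subseteq> U})"
    unfolding continuous_on_generated_topo_iff U pre[symmetric] by blast
  then show ?thesis
    unfolding topspace_compact_open
    unfolding compact_open_def continuous_map_in_subtopology by auto
qed

lemma continuous_map_eval_compact_open:
  assumes "a \<in> topspace X"
  shows "continuous_map (compact_open X Y) Y (\<lambda>f. f a)"
proof -
  have id: "continuous_map (compact_open X Y) (compact_open X Y) (\<lambda>f. f)"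
    by simp
  have "openin (compact_open X Y) {f \<in> topspace (compact_open X Y). f a \<in> U}"
    if "openin Y U" for U
  proof -
    have "compactin X {a}"
      using assms by (simp add: finite_imp_compactin)
    with id that have "openin (compact_open X Y) {f \<in> topspace (compact_open X Y). f ` {a} \<subseteq> U}"
      unfolding continuous_map_into_compact_open_iff by blast
    then show ?thesis by simp
  qed
  moreover have "f a \<in> topspace Y" if "f \<in> topspace (compact_open X Y)" for f
    using that assms by (auto simp: topspace_compact_open continuous_map_def)
  ultimately show ?thesis
    by (auto simp: continuous_map_def)
qed

lemma constant_map_in_compact_open:
  assumes "z \<in> topspace Z"
  shows "(\<lambda>_\<in>topspace X. z) \<in> topspace (compact_open X Z)"
proof -
  have "continuous_map X Z (\<lambda>_\<in>topspace X. z)"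
    by (rule continuous_map_eq[where f = "\<lambda>_. z"]) (use assms in auto)
  then show ?thesis
    by (simp add: topspace_compact_open)
qed

lemma continuous_map_into_constant_maps:
  "continuous_map Z (compact_open X Z) (\<lambda>z. \<lambda>_\<in>topspace X. z)"
  unfolding continuous_map_into_compact_open_iff
proof (intro conjI allI impI)
  show "(\<lambda>z. \<lambda>_\<in>topspace X. z) \<in> topspace Z \<rightarrow> topspace (compact_open X Z)"
    by (simp add: constant_map_in_compact_open)
next
  fix K U
  assume KU: "compactin X K \<and> openin Z U"
  then have K: "K \<subseteq> topspace X"
    by (simp add: compactin_subset_topspace)
  show "openin Z {z \<in> topspace Z. (\<lambda>_\<in>topspace X. z) ` K \<subseteq> U}"
  proof (cases "K = {}")
    case False
    with K KU openin_subset[of Z U]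
    have "{z \<in> topspace Z. (\<lambda>_\<in>topspace X. z) ` K \<subseteq> U} = U"
      by (auto simp: image_subset_iff subset_iff)
    with KU show ?thesis by simp
  qed simp
qed

section \<open>Postcomposition with an embedding\<close>

lemma embedding_map_openin_pullback:
  assumes "embedding_map Y Z e" "openin Y U"
  obtains W where "openin Z W" "\<And>y. y \<in> topspace Y \<Longrightarrow> e y \<in> W \<longleftrightarrow> y \<in> U"
proof -
  have hom: "homeomorphic_map Y (subtopology Z (e ` topspace Y)) e"
    using assms by (simp add: embedding_map_def)
  have U: "U \<subseteq> topspace Y"
    using assms openin_subset by blast
  have "openin (subtopology Z (e ` topspace Y)) (e ` U)"
    using homeomorphic_map_openness[OF hom U] assms(2) by simp
  then obtain W where W: "openin Z W" "e ` U = W \<inter> e ` topspace Y"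
    by (auto simp: openin_subtopology)
  have "inj_on e (topspace Y)"
    using hom by (simp add: homeomorphic_eq_everything_map)
  then have "e y \<in> e ` U \<longleftrightarrow> y \<in> U" if "y \<in> topspace Y" for y
    using that U by (simp add: inj_on_image_mem_iff)
  then have "e y \<in> W \<longleftrightarrow> y \<in> U" if "y \<in> topspace Y" for y
    using that W by blast
  with W show thesis
    by (intro that) auto
qed

lemma embedding_imp_continuous_map:
  "embedding_map Y Z e \<Longrightarrow> continuous_map Y Z e"
  by (metis continuous_map_in_subtopology embedding_map_def homeomorphic_imp_continuous_map)

lemma continuous_map_embedding_iff:
  assumes "embedding_map Y Z e" "f \<in> topspace T \<rightarrow> topspace Y"
  shows "continuous_map T Z (e \<circ> f) \<longleftrightarrow> continuous_map T Y f"
proof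
  assume L: "continuous_map T Z (e \<circ> f)"
  have "openin T {x \<in> topspace T. f x \<in> U}" if U: "openin Y U" for U
  proof -
    obtain W where W: "openin Z W" "\<And>y. y \<in> topspace Y \<Longrightarrow> e y \<in> W \<longleftrightarrow> y \<in> U"
      using embedding_map_openin_pullback[OF assms(1) U] by blast
    have "{x \<in> topspace T. f x \<in> U} = {x \<in> topspace T. (e \<circ> f) x \<in> W}"
      using W(2) assms(2) by (auto simp: Pi_iff)
    with L W(1) show ?thesis
      by (simp add: continuous_map_def)
  qed
  with assms(2) show "continuous_map T Y f"
    by (simp add: continuous_map_def)
next
  show "continuous_map T Z (e \<circ> f)" if "continuous_map T Y f"
    using continuous_map_compose[OF that embedding_imp_continuous_map[OF assms(1)]] .
qed

lemma compose_embedding_in_compact_open: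
  assumes "embedding_map Y Z e" "f \<in> topspace (compact_open X Y)"
  shows "compose (topspace X) e f \<in> topspace (compact_open X Z)"
proof -
  have "continuous_map X Z (e \<circ> f)"
    using assms(2) embedding_imp_continuous_map[OF assms(1)]
    by (auto simp: topspace_compact_open intro: continuous_map_compose)
  then have "continuous_map X Z (compose (topspace X) e f)"
    by (rule continuous_map_eq) (simp add: compose_def)
  then show ?thesis
    by (simp add: topspace_compact_open)
qed

text \<open>
  An open \<open>U\<close> of \<open>Y\<close> is the trace of an open \<open>W\<close> of \<open>Z\<close>, and a map \<open>f\<close> into \<open>Y\<close> sends \<open>K\<close> into \<open>U\<close>
  exactly if \<open>e \<circ> f\<close> sends \<open>K\<close> into \<open>W\<close>. So the subbasic open sets of the two function spaces
  correspond.
\<close>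

lemma continuous_map_compact_open_embedding_iff:
  assumes e: "embedding_map Y Z e"
    and F: "F \<in> topspace T \<rightarrow> topspace (compact_open X Y)"
  shows "continuous_map T (compact_open X Z) (\<lambda>x. compose (topspace X) e (F x)) \<longleftrightarrow>
    continuous_map T (compact_open X Y) F"
    (is "continuous_map T _ ?G \<longleftrightarrow> _")
proof -
  have G: "?G \<in> topspace T \<rightarrow> topspace (compact_open X Z)"
    using compose_embedding_in_compact_open[OF e] F by blast
  have FY: "F x t \<in> topspace Y" if "x \<in> topspace T" "t \<in> topspace X" for x t
    using F that by (auto simp: topspace_compact_open continuous_map_def Pi_iff)
  have eq: "{x \<in> topspace T. ?G x ` K \<subseteq> W} = {x \<in> topspace T. F x ` K \<subseteq> U}"
    if "compactin X K" and WU: "\<forall>y\<in>topspace Y. e y \<in> W \<longleftrightarrow> y \<in> U" for K U W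
  proof -
    have "K \<subseteq> topspace X"
      using that(1) by (rule compactin_subset_topspace)
    then have "e (F x t) \<in> W \<longleftrightarrow> F x t \<in> U" "?G x t = e (F x t)"
      if "x \<in> topspace T" "t \<in> K" for x t
      using FY that WU by (auto simp: compose_def)
    then have "?G x ` K \<subseteq> W \<longleftrightarrow> F x ` K \<subseteq> U" if "x \<in> topspace T" for x
      using that by (simp add: image_subset_iff)
    then show ?thesis by blast
  qed
  show ?thesis
  proof
    assume L: "continuous_map T (compact_open X Z) ?G"
    have "openin T {x \<in> topspace T. F x ` K \<subseteq> U}" if K: "compactin X K" and U: "openin Y U" for K U
    proof -
      obtain W where W: "openin Z W" "\<forall>y\<in>topspace Y. e y \<in> W \<longleftrightarrow> y \<in> U"
        using embedding_map_openin_pullback[OF e U] by metis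
      have "openin T {x \<in> topspace T. ?G x ` K \<subseteq> W}"
        using L K W(1) unfolding continuous_map_into_compact_open_iff by blast
      then show ?thesis
        by (simp only: eq[OF K W(2)])
    qed
    with F show "continuous_map T (compact_open X Y) F"
      unfolding continuous_map_into_compact_open_iff by blast
  next
    assume R: "continuous_map T (compact_open X Y) F"
    have "openin T {x \<in> topspace T. ?G x ` K \<subseteq> W}" if K: "compactin X K" and W: "openin Z W" for K W
    proof -
      define U where "U = {y \<in> topspace Y. e y \<in> W}"
      have U: "openin Y U"
        using embedding_imp_continuous_map[OF e] W by (simp add: U_def continuous_map_def)
      then have "openin T {x \<in> topspace T. F x ` K \<subseteq> U}"
        using R K unfolding continuous_map_into_compact_open_iff by blast
      moreover have eU: "\<forall>y\<in>topspace Y. e y \<in> W \<longleftrightarrow> y \<in> U"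
        by (simp add: U_def)
      ultimately show ?thesis
        by (simp only: eq[OF K eU])
    qed
    with G show "continuous_map T (compact_open X Z) ?G"
      unfolding continuous_map_into_compact_open_iff by blast
  qed
qed

section \<open>Geodesics of a space as geodesics of its completion\<close>

lemma completion_embedding_map:
  assumes "is_completion X Y \<iota>"
  shows "embedding_map (mtopology_of X) (mtopology_of Y) \<iota>"
  using assms Metric_space12.isometry_imp_embedding_map[OF Metric_space12_mspace_mdist]
  unfolding mtopology_of_def is_completion_def by blast

lemma geodesic_in_path_space:
  "geodesic Z x0 x1 \<gamma> \<Longrightarrow> \<gamma> \<in> topspace (path_space (mtopology_of Z))"
  by (simp add: geodesic_def path_space_between_def)

lemma geodesic_completion:
  assumes c: "is_completion X Y \<iota>" and g: "geodesic X x0 x1 \<gamma>"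
  shows "geodesic Y (\<iota> x0) (\<iota> x1) (compose {0..1} \<iota> \<gamma>)"
proof -
  have "compose {0..1} \<iota> \<gamma> \<in> topspace (path_space (mtopology_of Y))"
    using compose_embedding_in_compact_open[OF completion_embedding_map[OF c] geodesic_in_path_space[OF g]]
    by simp
  moreover have ends: "\<gamma> 0 = x0" "\<gamma> 1 = x1"
    using g by (auto simp: geodesic_def path_space_between_def)
  moreover have mem: "\<gamma> t \<in> mspace X" if "t \<in> {0..1}" for t
    using geodesic_in_path_space[OF g] that
    by (auto simp: topspace_compact_open continuous_map_def Pi_iff)
  moreover have "x0 \<in> mspace X" "x1 \<in> mspace X"
    using mem[of 0] mem[of 1] ends by auto
  ultimately show ?thesis
    using c g by (auto simp: geodesic_def path_space_between_def is_completion_def compose_def)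
qed

lemma constant_near_geodesic:
  assumes c: "is_completion X Y \<iota>" and g: "geodesic X x0 x1 \<gamma>"
  shows "near_geodesic X Y \<iota> x0 x1 (\<lambda>_\<in>{0..1}. compose {0..1} \<iota> \<gamma>)"
proof -
  let ?g = "compose {0..1} \<iota> \<gamma>"
  have gY: "geodesic Y (\<iota> x0) (\<iota> x1) ?g"
    using geodesic_completion[OF c g] .
  then have "?g \<in> topspace (path_space_between (mtopology_of Y) (\<iota> x0) (\<iota> x1))"
    by (simp add: geodesic_def)
  then have "(\<lambda>_\<in>{0..1}. ?g) \<in> topspace (path_space (path_space_between (mtopology_of Y) (\<iota> x0) (\<iota> x1)))"
    using constant_map_in_compact_open[of ?g _ unit_interval] by simp
  moreover have "\<gamma> \<in> topspace (path_space_between (mtopology_of X) x0 x1)"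
    using g by (simp add: geodesic_def)
  moreover have "(\<lambda>n. path_length Y ((\<lambda>_\<in>{0..1}. ?g) (s n))) = (\<lambda>n. path_length Y ?g)"
    if "range s \<subseteq> {0..1}" for s :: "nat \<Rightarrow> real"
    using that by (auto simp: image_subset_iff)
  ultimately show ?thesis
    using gY unfolding near_geodesic_def by auto
qed

section \<open>The two kinds of motion planning rules\<close>

lemma RM_rule_imp_NGMPR:
  assumes c: "is_completion X Y \<iota>" and E: "E \<subseteq> mspace X \<times> mspace X" and s: "RM_rule X E s"
  shows "NGMPR X Y \<iota> E (\<lambda>x. \<lambda>_\<in>{0..1}. compose {0..1} \<iota> (s x))"
proof -
  let ?T = "subtopology (square X) E"
  have cs: "continuous_map ?T (path_space (mtopology_of X)) s"
    and geo: "\<And>x0 x1. (x0, x1) \<in> E \<Longrightarrow> geodesic X x0 x1 (s (x0, x1))"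
    using s by (auto simp: RM_rule_def)
  have "continuous_map ?T (path_space (mtopology_of Y)) (\<lambda>x. compose {0..1} \<iota> (s x))"
    using continuous_map_compact_open_embedding_iff[OF completion_embedding_map[OF c], of s ?T unit_interval]
      cs continuous_map_funspace[OF cs] by simp
  then have "continuous_map ?T (path_space (path_space (mtopology_of Y)))
      (\<lambda>x. \<lambda>_\<in>{0..1}. compose {0..1} \<iota> (s x))"
    using continuous_map_compose[OF _ continuous_map_into_constant_maps[where X = unit_interval],
        of ?T _ "\<lambda>x. compose {0..1} \<iota> (s x)"]
    by (simp add: o_def)
  then show ?thesis
    using constant_near_geodesic[OF c geo] geo by (auto simp: NGMPR_def)
qed

text \<open>
  The geodesic \<open>s x\<close> is picked pointwise, with no regard to continuity. This is harmless: \<open>\<iota>\<close> is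
  injective, so \<open>s x\<close> is the only path of \<open>X\<close> that \<open>\<iota>\<close> carries to \<open>\<Phi> x 0\<close>, and its continuity in
  \<open>x\<close> is inherited from that of \<open>\<Phi>\<close>.
\<close>

lemma NGMPR_imp_RM_rule:
  assumes X: "geodesic_space X" and c: "is_completion X Y \<iota>"
    and E: "E \<subseteq> mspace X \<times> mspace X" and N: "NGMPR X Y \<iota> E \<Phi>"
  shows "\<exists>s. RM_rule X E s"
proof -
  let ?T = "subtopology (square X) E"
  have cN: "continuous_map ?T (path_space (path_space (mtopology_of Y))) \<Phi>"
    using N by (simp add: NGMPR_def)
  have "\<exists>\<gamma>. geodesic X (fst x) (snd x) \<gamma> \<and> \<Phi> x 0 = compose {0..1} \<iota> \<gamma>" if "x \<in> E" for x
  proof -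
    obtain x0 x1 where x: "x = (x0, x1)"
      by fastforce
    with that E X have "\<exists>\<gamma>. geodesic X x0 x1 \<gamma>"
      unfolding geodesic_space_def by blast
    with N that x show ?thesis
      unfolding NGMPR_def by fastforce
  qed
  then obtain s where geo: "\<And>x. x \<in> E \<Longrightarrow> geodesic X (fst x) (snd x) (s x)"
    and s: "\<And>x. x \<in> E \<Longrightarrow> \<Phi> x 0 = compose {0..1} \<iota> (s x)"
    by metis
  have "continuous_map ?T (path_space (mtopology_of Y)) ((\<lambda>\<phi>. \<phi> 0) \<circ> \<Phi>)"
    by (rule continuous_map_compose[OF cN continuous_map_eval_compact_open]) simp
  then have "continuous_map ?T (path_space (mtopology_of Y)) (\<lambda>x. compose {0..1} \<iota> (s x))"
    by (rule continuous_map_eq) (simp add: s)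
  moreover have "s \<in> topspace ?T \<rightarrow> topspace (path_space (mtopology_of X))"
    using geodesic_in_path_space[OF geo] by simp
  ultimately have "continuous_map ?T (path_space (mtopology_of X)) s"
    using continuous_map_compact_open_embedding_iff[OF completion_embedding_map[OF c], of s ?T unit_interval]
    by simp
  then have "RM_rule X E s"
    using geo by (auto simp: RM_rule_def)
  then show ?thesis
    by blast
qed

theorem proposition1p3:
  fixes X :: "'a metric" and Y :: "'b metric" and \<iota> :: "'a \<Rightarrow> 'b"
  assumes "geodesic_space X"
    and "is_completion X Y \<iota>"
    and "geodesic_space Y"
  shows "GC X Y \<iota> = GC_RM X"
proof -
  have "(\<exists>\<Phi>. NGMPR X Y \<iota> E \<Phi>) \<longleftrightarrow> (\<exists>s. RM_rule X E s)" if "E \<subseteq> mspace X \<times> mspace X" for E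
    using RM_rule_imp_NGMPR[OF assms(2) that] NGMPR_imp_RM_rule[OF assms(1,2) that] by blast
  moreover have "E i \<subseteq> mspace X \<times> mspace X" if "lc_partition X k E" "i \<le> k" for k E i
    using that unfolding lc_partition_def by blast
  ultimately have "(\<exists>E. lc_partition X k E \<and> (\<forall>i\<le>k. \<exists>\<Phi>. NGMPR X Y \<iota> (E i) \<Phi>)) \<longleftrightarrow>
      (\<exists>E. lc_partition X k E \<and> (\<forall>i\<le>k. \<exists>s. RM_rule X (E i) s))" for k
    by meson
  then show ?thesis
    by (simp add: GC_def GC_RM_def)
qed

end
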